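(* Let $G$ be an $r_1$-regular graph with $n$ vertices and $m$ edges, and let $H_1,\ldots,H_m,F_1,\ldots,F_m$ be $2m$ $r_2$-regular graphs, each of them with the same order $q$. Suppose that $H_i$ and $F_i$ are $m$ pairs of $A_\alpha$-cospectral graphs for $i=1,2,\ldots,m$. Then for any real $\alpha\in[0,1]$, $G[H_i]_1^m$ and $G[F_i]_1^m$ are $A_\alpha$-cospectral graphs.
   Context: All graphs are simple and undirected. For a graph $G$ with adjacency matrix $A(G)$ and diagonal matrix of vertex degrees $D(G)$, and real $\alpha\in[0,1]$, $A_\alpha(G)=\alpha D(G)+(1-\alpha)A(G)$; the $A_\alpha$-spectrum of $G$ is the collection of eigenvalues of $A_\alpha(G)$ together with multiplicities. Two non-isomorphic graphs are said to be $A_\alpha$-cospectral if they have the same $A_\alpha$-spectrum. For a simple graph $G$ with $m$ edges and $m$ simple graphs $H_1,\ldots,H_m$, the generalized edge corona $G[H_i]_1^m$ is the graph obtained by taking one copy of the graphs $G,H_1,\ldots,H_m$ and then joining the two end-vertices of the $i$th edge of $G$ to every vertex of $H_i$, for $1\le i\le m$; $G[F_i]_1^m$ is defined in the same way with $F_i$ in place of $H_i$.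
   Formalization: The two coronas can be isomorphic (e.g. G = 2K_2, H = (X,Y), F = (Y,X)), so the result proved is that their A_α-spectra are equal, and that they are A_α-cospectral in the sense requiring non-isomorphism whenever they are non-isomorphic. *)

theory Defs
  imports
    Complex_Main
    "Graph_Theory.Pair_Digraph"
    "Graph_Theory.Digraph_Isomorphism"
    "Jordan_Normal_Form.Char_Poly"
begin

text \<open>
  Finite simple undirected graphs are \<open>pair_graph\<close>s: finite, loop-free, with a symmetric
  arc relation. The undirected edge \<open>{u, v}\<close> corresponds to the two arcs \<open>(u, v)\<close> and \<open>(v, u)\<close>,
  so the degree of a vertex is its out-degree.
\<close>

definition edges :: "'a pair_pre_digraph \<Rightarrow> 'a set set" where
  "edges G = {{u, v} |u v. (u, v) \<in> parcs G}"

definition degree_of :: "'a pair_pre_digraph \<Rightarrow> 'a \<Rightarrow> nat" where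
  "degree_of G v = out_degree (with_proj G) v"

definition regular :: "nat \<Rightarrow> 'a pair_pre_digraph \<Rightarrow> bool" where
  "regular r G \<longleftrightarrow> (\<forall>v \<in> pverts G. degree_of G v = r)"

definition isomorphic :: "'a pair_pre_digraph \<Rightarrow> 'b pair_pre_digraph \<Rightarrow> bool" where
  "isomorphic G H \<longleftrightarrow> digraph_iso (with_proj G) (with_proj H)"

text \<open>
  Matrices are indexed by \<open>0, 1, \<dots>\<close>, so the vertices have to be listed in some order.
  Reordering them conjugates the matrices below by a permutation matrix, which does not affect
  the spectrum.
\<close>

definition vertex_list :: "'a pair_pre_digraph \<Rightarrow> 'a list" where
  "vertex_list G = (SOME vs. distinct vs \<and> set vs = pverts G)"

definition adjacency_matrix :: "'a pair_pre_digraph \<Rightarrow> real mat" where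
  "adjacency_matrix G = (let vs = vertex_list G; n = length vs in
     mat n n (\<lambda>(i, j). if (vs ! i, vs ! j) \<in> parcs G then 1 else 0))"

definition degree_matrix :: "'a pair_pre_digraph \<Rightarrow> real mat" where
  "degree_matrix G = (let vs = vertex_list G; n = length vs in
     mat n n (\<lambda>(i, j). if i = j then real (degree_of G (vs ! i)) else 0))"

definition A_alpha :: "real \<Rightarrow> 'a pair_pre_digraph \<Rightarrow> real mat" where
  "A_alpha \<alpha> G = \<alpha> \<cdot>\<^sub>m degree_matrix G + (1 - \<alpha>) \<cdot>\<^sub>m adjacency_matrix G"

text \<open>
  The multiset of eigenvalues, as roots of the characteristic polynomial. They are taken in the
  complex numbers so that no eigenvalue is lost by definition; \<open>A_alpha \<alpha> G\<close> is real symmetric, so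
  all of them are in fact real and their algebraic and geometric multiplicities agree.
\<close>

definition A_alpha_spectrum :: "real \<Rightarrow> 'a pair_pre_digraph \<Rightarrow> complex multiset" where
  "A_alpha_spectrum \<alpha> G = proots (char_poly (map_mat complex_of_real (A_alpha \<alpha> G)))"

definition A_alpha_cospectral :: "real \<Rightarrow> 'a pair_pre_digraph \<Rightarrow> 'b pair_pre_digraph \<Rightarrow> bool" where
  "A_alpha_cospectral \<alpha> G H \<longleftrightarrow>
     \<not> isomorphic G H \<and> A_alpha_spectrum \<alpha> G = A_alpha_spectrum \<alpha> H"

text \<open>
  The generalized edge corona of \<open>G\<close> and \<open>H 1, \<dots>, H m\<close>, where \<open>e 1, \<dots>, e m\<close> lists the edges
  of \<open>G\<close>. The vertices of \<open>G\<close> are tagged by \<open>Inl\<close>, the vertex \<open>x\<close> of the copy of \<open>H i\<close>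
  is \<open>Inr (i, x)\<close>.
\<close>

definition edge_corona ::
  "'a pair_pre_digraph \<Rightarrow> nat \<Rightarrow> (nat \<Rightarrow> 'a set) \<Rightarrow> (nat \<Rightarrow> 'b pair_pre_digraph)
     \<Rightarrow> ('a + nat \<times> 'b) pair_pre_digraph" where
  "edge_corona G m e H = \<lparr>
     pverts = Inl ` pverts G \<union> {Inr (i, x) |i x. i \<in> {1..m} \<and> x \<in> pverts (H i)},
     parcs =
       {(Inl u, Inl v) |u v. (u, v) \<in> parcs G}
       \<union> {(Inr (i, x), Inr (i, y)) |i x y. i \<in> {1..m} \<and> (x, y) \<in> parcs (H i)}
       \<union> {(Inl u, Inr (i, x)) |u i x. i \<in> {1..m} \<and> u \<in> e i \<and> x \<in> pverts (H i)}
       \<union> {(Inr (i, x), Inl u) |u i x. i \<in> {1..m} \<and> u \<in> e i \<and> x \<in> pverts (H i)} \<rparr>"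

lemma pair_graph_edge_corona:
  assumes G: "pair_graph G"
    and H: "\<And>i. i \<in> {1..m} \<Longrightarrow> pair_graph (H i)"
    and e: "bij_betw e {1..m} (edges G)"
  shows "pair_graph (edge_corona G m e H)"
proof -
  let ?C = "edge_corona G m e H"
  interpret G: pair_graph G by fact
  have eV: "u \<in> pverts G" if "i \<in> {1..m}" "u \<in> e i" for i u
  proof -
    have "e i \<in> edges G" using e that(1) by (auto simp: bij_betw_def)
    then obtain a b where "e i = {a, b}" "(a, b) \<in> parcs G" by (auto simp: edges_def)
    then show ?thesis using that(2) G.arc_fst_in_verts G.arc_snd_in_verts by fastforce
  qed
  have HV: "x \<in> pverts (H i) \<and> y \<in> pverts (H i) \<and> x \<noteq> y \<and> (y, x) \<in> parcs (H i)"
    if "i \<in> {1..m}" "(x, y) \<in> parcs (H i)" for i x y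
  proof -
    interpret Hi: pair_graph "H i" using H that(1) .
    show ?thesis
      using that(2) Hi.arc_fst_in_verts Hi.arc_snd_in_verts Hi.pair_no_loops Hi.arcs_symmetric
      by fastforce
  qed
  have GV: "u \<in> pverts G \<and> v \<in> pverts G \<and> u \<noteq> v \<and> (v, u) \<in> parcs G"
    if "(u, v) \<in> parcs G" for u v
    using that G.arc_fst_in_verts G.arc_snd_in_verts G.pair_no_loops G.arcs_symmetric
    by fastforce
  have "pverts ?C = Inl ` pverts G \<union> Inr ` (SIGMA i:{1..m}. pverts (H i))"
    by (auto simp: edge_corona_def)
  moreover have "finite (pverts (H i))" if "i \<in> {1..m}" for i
    using H[OF that] by (simp add: pair_graph_def pair_digraph_def pair_fin_digraph.pair_finite_verts)
  ultimately have fin: "finite (pverts ?C)"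
    using G.pair_finite_verts by auto
  have arcs: "fst a \<in> pverts ?C \<and> snd a \<in> pverts ?C \<and> fst a \<noteq> snd a \<and> (snd a, fst a) \<in> parcs ?C"
    if "a \<in> parcs ?C" for a
    using that by (auto simp: edge_corona_def simp del: atLeastAtMost_iff One_nat_def dest: GV HV intro: eV)
  then have "parcs ?C \<subseteq> pverts ?C \<times> pverts ?C"
    by force
  with fin have "finite (parcs ?C)"
    by (meson finite_SigmaI finite_subset)
  with fin arcs show ?thesis
    by unfold_locales (auto simp: symmetric_def arcs_ends_def arc_to_ends_def sym_def with_proj_def)
qed

end

theory Submission
  imports Defs
begin

text \<open>
  List the vertices of the corona of \<open>G\<close> and \<open>H 1, \<dots>, H m\<close> with those of \<open>G\<close> first. The
  characteristic matrix of its \<open>A\<^sub>\<alpha>\<close>-matrix then has the block form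
    \<open>[[X, - c R], [- c R\<^sup>T, Y]]\<close>  with  \<open>c = 1 - \<alpha>\<close>,
  where \<open>R\<close> is the incidence matrix of \<open>G\<close> with the column of edge \<open>i\<close> repeated \<open>q\<close> times, once
  for each vertex of \<open>H i\<close>, and \<open>Y\<close> is block diagonal. A vertex of \<open>H i\<close> gains two
  neighbours in the corona, so the blocks of \<open>Y\<close> are \<open>(x - 2 \<alpha>) I - A\<^sub>\<alpha>(H i)\<close>.

  The columns of \<open>R\<^sup>T\<close> are constant on every \<open>H i\<close>, and since \<open>H i\<close> is \<open>r\<close>-regular the constant
  vectors are eigenvectors of \<open>A\<^sub>\<alpha>(H i)\<close> for the eigenvalue \<open>r\<close>, whatever \<open>\<alpha>\<close> is. Hence
  \<open>Y R\<^sup>T = (x - s) R\<^sup>T\<close> for \<open>s = r + 2 \<alpha>\<close>, and for \<open>x \<noteq> s\<close> adding the last columns multiplied by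
  \<open>c / (x - s) R\<^sup>T\<close> to the first ones clears the lower left block. The determinant becomes
    \<open>det (X - c\<^sup>2 / (x - s) R R\<^sup>T) * (\<Prod>i. char_poly (A\<^sub>\<alpha>(H i)) (x - 2 \<alpha>))\<close>
  (lemma \<open>char_poly_edge_corona\<close>, from the elimination lemma \<open>det_list_mat_schur\<close>). The first factor
  only depends on \<open>G\<close>, the enumeration of its edges, \<open>q\<close>, \<open>r\<close> and \<open>\<alpha>\<close>; the second only on the
  spectra of the \<open>H i\<close>. So replacing every \<open>H i\<close> by a cospectral \<open>F i\<close> does not change the
  characteristic polynomial at any \<open>x \<noteq> s\<close>, and two polynomials that agree off one point are equal.
\<close>

section \<open>Determinants indexed by lists of vertices\<close>

definition list_mat :: "'v list \<Rightarrow> ('v \<Rightarrow> 'v \<Rightarrow> 'a) \<Rightarrow> 'a mat" where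
  "list_mat vs f = mat (length vs) (length vs) (\<lambda>(i, j). f (vs ! i) (vs ! j))"

lemma list_mat_carrier [simp]: "list_mat vs f \<in> carrier_mat (length vs) (length vs)"
  by (simp add: list_mat_def)

lemma list_mat_map: "list_mat (map h vs) f = list_mat vs (\<lambda>u v. f (h u) (h v))"
  by (rule eq_matI) (auto simp: list_mat_def)

lemma list_mat_cong:
  assumes "\<And>u v. u \<in> set vs \<Longrightarrow> v \<in> set vs \<Longrightarrow> f u v = g u v"
  shows "list_mat vs f = list_mat vs g"
  using assms by (intro eq_matI) (auto simp: list_mat_def)

text \<open>
  This is what makes the arbitrary choice in \<open>vertex_list\<close> harmless: a reordering permutes rows and
  columns alike, and the two signs cancel.
\<close>

lemma det_list_mat_reorder:
  fixes f :: "'v \<Rightarrow> 'v \<Rightarrow> 'a :: comm_ring_1"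
  assumes "distinct us" and "distinct vs" and "set us = set vs"
  shows "det (list_mat us f) = det (list_mat vs f)"
proof -
  have "mset us = mset vs"
    using assms set_eq_iff_mset_eq_distinct by blast
  then obtain p where p: "p permutes {..<length vs}" and us: "permute_list p vs = us"
    by (rule mset_eq_permutation)
  define n where "n = length vs"
  have p': "p permutes {0..<n}"
    using p by (simp add: n_def atLeast0LessThan)
  have pn: "p i < n" if "i < n" for i
    using permutes_in_image[OF p'] that by simp
  have len: "length us = n"
    using us n_def by auto
  have nth: "us ! i = vs ! p i" if "i < n" for i
    using us p that permute_list_nth n_def by blast
  define A where "A = list_mat vs f"
  \<comment> \<open>Only rows can be permuted directly, so the columns are permuted as rows of the transpose.\<close>
  define B where "B = mat n n (\<lambda>(i, j). transpose_mat A $$ (p i, j))"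
  have A: "A \<in> carrier_mat n n" and B: "B \<in> carrier_mat n n"
    by (auto simp: A_def B_def n_def)
  have eq: "list_mat us f = mat n n (\<lambda>(i, j). transpose_mat B $$ (p i, j))"
    by (rule eq_matI) (auto simp: list_mat_def len nth pn A_def B_def n_def[symmetric])
  have "det (list_mat us f) = signof p * det B"
    unfolding eq using det_permute_rows[of "transpose_mat B" n p] det_transpose[OF B] B p' by simp
  also have "det B = signof p * det A"
    unfolding B_def using det_permute_rows[of "transpose_mat A" n p] det_transpose[OF A] A p' by simp
  also have "signof p * (signof p * det A) = det A"
    by (cases p rule: sign_cases) simp_all
  finally show ?thesis
    by (simp add: A_def)
qed

text \<open>
  Block elimination without inverting the block on \<open>ws\<close>: it suffices to exhibit a \<open>g\<close> such that
  adding the \<open>g\<close>-combinations of the columns \<open>ws\<close> to the columns \<open>us\<close> clears the lower left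
  block. The entries on \<open>us\<close> then become those of the Schur complement.
\<close>

lemma det_list_mat_schur:
  fixes f :: "'v \<Rightarrow> 'v \<Rightarrow> 'a :: idom"
  assumes "distinct ws"
    and elim: "\<And>w u. w \<in> set ws \<Longrightarrow> u \<in> set us \<Longrightarrow> f w u + (\<Sum>v\<in>set ws. f w v * g v u) = 0"
  shows "det (list_mat (us @ ws) f) =
    det (list_mat us (\<lambda>u v. f u v + (\<Sum>w\<in>set ws. f u w * g w v))) * det (list_mat ws f)"
proof -
  define n m where "n = length us" and "m = length ws"
  define B C G where "B = mat n m (\<lambda>(i, j). f (us ! i) (ws ! j))"
    and "C = mat m n (\<lambda>(i, j). f (ws ! i) (us ! j))"
    and "G = mat m n (\<lambda>(i, j). g (ws ! i) (us ! j))"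
  define A D where "A = list_mat us f" and "D = list_mat ws f"
  have cA: "A \<in> carrier_mat n n" and cB: "B \<in> carrier_mat n m" and cC: "C \<in> carrier_mat m n"
    and cD: "D \<in> carrier_mat m m" and cG: "G \<in> carrier_mat m n"
    by (auto simp: A_def B_def C_def D_def G_def n_def m_def)
  have sum_ws: "(\<Sum>k\<in>{0..<m}. h (ws ! k)) = (\<Sum>w\<in>set ws. h w)" for h :: "'v \<Rightarrow> 'a"
    using sum_list_distinct_conv_sum_set[OF \<open>distinct ws\<close>, of h]
    by (simp add: sum_list_sum_nth m_def)
  let ?E = "four_block_mat (1\<^sub>m n) (0\<^sub>m n m) G (1\<^sub>m m)"
  have split: "list_mat (us @ ws) f = four_block_mat A B C D"
    by (rule eq_matI)
      (auto simp: list_mat_def A_def B_def C_def D_def n_def m_def nth_append)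
  have "four_block_mat A B C D * ?E = four_block_mat (A + B * G) B (C + D * G) D"
    using cA cB cC cD cG
    by (subst mult_four_block_mat[OF cA cB cC cD]) (auto intro!: cong_four_block_mat)
  moreover have "C + D * G = 0\<^sub>m m n"
    by (rule eq_matI)
      (use elim in \<open>auto simp: C_def D_def G_def list_mat_def scalar_prod_def n_def
         m_def[symmetric] sum_ws[where h = "\<lambda>w. f _ w * g w _"]\<close>)
  moreover have "A + B * G = list_mat us (\<lambda>u v. f u v + (\<Sum>w\<in>set ws. f u w * g w v))"
    by (rule eq_matI)
      (auto simp: A_def B_def G_def list_mat_def scalar_prod_def n_def
         m_def[symmetric] sum_ws[where h = "\<lambda>w. f _ w * g w _"])
  ultimately have prod: "four_block_mat A B C D * ?E =
      four_block_mat (list_mat us (\<lambda>u v. f u v + (\<Sum>w\<in>set ws. f u w * g w v))) B (0\<^sub>m m n) D"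
    by simp
  have "det ?E = 1"
    using cG by (subst det_four_block_mat_upper_right_zero[of _ n _ m]) auto
  then have "det (four_block_mat A B C D) = det (four_block_mat A B C D * ?E)"
    using cA cD by (subst det_mult[of _ "n + m"]) auto
  then show ?thesis
    unfolding prod split
    using cB cD by (subst (asm) det_four_block_mat_lower_left_zero[of _ n _ m])
      (auto simp: D_def n_def)
qed

lemma det_list_mat_concat:
  fixes f :: "'v \<Rightarrow> 'v \<Rightarrow> 'a :: idom"
  assumes "distinct (concat vss)"
    and "sorted_wrt (\<lambda>us ws. \<forall>u\<in>set us. \<forall>w\<in>set ws. f w u = 0) vss"
  shows "det (list_mat (concat vss) f) = (\<Prod>vs\<leftarrow>vss. det (list_mat vs f))"
  using assms
proof (induction vss)
  case Nil
  then show ?case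
    by (simp add: list_mat_def)
next
  case (Cons vs vss)
  then have "det (list_mat (vs @ concat vss) f) = det (list_mat vs f) * det (list_mat (concat vss) f)"
    using det_list_mat_schur[of "concat vss" vs f "\<lambda>_ _. 0"] by auto
  with Cons show ?case
    by simp
qed

section \<open>Characteristic polynomials and spectra\<close>

text \<open>
  The entries of \<open>x I - f\<close>, indexed by the vertices themselves, so that they survive a change of the
  vertex order.
\<close>

definition char_entry :: "'a :: comm_ring_1 \<Rightarrow> ('v \<Rightarrow> 'v \<Rightarrow> 'a) \<Rightarrow> 'v \<Rightarrow> 'v \<Rightarrow> 'a" where
  "char_entry x f u v = (if u = v then x else 0) - f u v"

lemma poly_char_poly_list_mat:
  fixes f :: "'v \<Rightarrow> 'v \<Rightarrow> 'a :: field"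
  assumes "distinct vs"
  shows "poly (char_poly (list_mat vs f)) x = det (list_mat vs (char_entry x f))"
proof -
  have "- char_matrix (list_mat vs f) x = list_mat vs (char_entry x f)"
    by (rule eq_matI)
      (use assms in \<open>auto simp: char_matrix_def list_mat_def char_entry_def nth_eq_iff_index_eq\<close>)
  then show ?thesis
    by (simp add: char_poly_matrix[OF list_mat_carrier])
qed

text \<open>
  A monic complex polynomial is the product of the linear factors given by its roots, and a real
  polynomial is determined by its complexification; so all spectral questions can be settled on real
  characteristic polynomials.
\<close>

lemma complex_spectrum_eq_iff:
  fixes A B :: "real mat"
  assumes A: "A \<in> carrier_mat k k" and B: "B \<in> carrier_mat l l"
  shows "proots (char_poly (map_mat complex_of_real A)) = proots (char_poly (map_mat complex_of_real B))
    \<longleftrightarrow> char_poly A = char_poly B"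
proof
  let ?p = "\<lambda>M. char_poly (map_mat complex_of_real M)"
  assume eq: "proots (?p A) = proots (?p B)"
  have monic: "lead_coeff (?p M) = 1" if "M \<in> carrier_mat n n" for M :: "real mat" and n
    using degree_monic_char_poly[of "map_mat complex_of_real M" n] that by simp
  have "?p A = ?p B"
    using complex_poly_decompose_multiset[of "?p A"] complex_poly_decompose_multiset[of "?p B"]
      monic[OF A] monic[OF B] eq by simp
  then show "char_poly A = char_poly B"
    by (simp add: of_real_hom.char_poly_hom[OF A] of_real_hom.char_poly_hom[OF B]
        poly_eq_iff coeff_map_poly)
qed (simp add: of_real_hom.char_poly_hom[OF A] of_real_hom.char_poly_hom[OF B])

section \<open>The matrix of a graph\<close>

definition alpha_entry :: "real \<Rightarrow> 'a pair_pre_digraph \<Rightarrow> 'a \<Rightarrow> 'a \<Rightarrow> real" where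
  "alpha_entry \<alpha> G u v =
     \<alpha> * (if u = v then real (degree_of G u) else 0) + (1 - \<alpha>) * (if (u, v) \<in> parcs G then 1 else 0)"

lemma pair_graph_finite_verts: "pair_graph G \<Longrightarrow> finite (pverts G)"
  by (simp add: pair_graph_def pair_digraph_def pair_fin_digraph.pair_finite_verts)

lemma vertex_list:
  assumes "pair_graph G"
  shows "distinct (vertex_list G)" and "set (vertex_list G) = pverts G"
proof -
  obtain vs where "distinct vs \<and> set vs = pverts G"
    using finite_distinct_list[OF pair_graph_finite_verts[OF assms]] by blast
  then have "distinct (vertex_list G) \<and> set (vertex_list G) = pverts G"
    unfolding vertex_list_def by (rule someI)
  then show "distinct (vertex_list G)" and "set (vertex_list G) = pverts G"
    by auto
qed

lemma A_alpha_list_mat: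
  assumes "pair_graph G"
  shows "A_alpha \<alpha> G = list_mat (vertex_list G) (alpha_entry \<alpha> G)"
  by (rule eq_matI)
    (use vertex_list(1)[OF assms] in \<open>auto simp: A_alpha_def degree_matrix_def adjacency_matrix_def
       Let_def list_mat_def alpha_entry_def nth_eq_iff_index_eq\<close>)

lemma A_alpha_spectrum_eq_iff:
  assumes "pair_graph G" and "pair_graph H"
  shows "A_alpha_spectrum \<alpha> G = A_alpha_spectrum \<alpha> H
    \<longleftrightarrow> char_poly (A_alpha \<alpha> G) = char_poly (A_alpha \<alpha> H)"
  unfolding A_alpha_spectrum_def A_alpha_list_mat[OF assms(1)] A_alpha_list_mat[OF assms(2)]
  by (rule complex_spectrum_eq_iff[OF list_mat_carrier list_mat_carrier])

lemma poly_char_poly_A_alpha: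
  assumes "pair_graph G" and "distinct vs" and "set vs = pverts G"
  shows "poly (char_poly (A_alpha \<alpha> G)) x = det (list_mat vs (char_entry x (alpha_entry \<alpha> G)))"
  using assms vertex_list[OF assms(1)]
  by (simp add: A_alpha_list_mat poly_char_poly_list_mat det_list_mat_reorder[of "vertex_list G" vs])

lemma degree_of_card: "degree_of G u = card {v. (u, v) \<in> parcs G}"
proof -
  have "out_arcs (with_proj G) u = Pair u ` {v. (u, v) \<in> parcs G}"
    by (auto simp: out_arcs_def)
  then show ?thesis
    by (simp add: degree_of_def out_degree_def card_image inj_on_def)
qed

lemma neighbours_subset:
  assumes "pair_graph G"
  shows "{v. (u, v) \<in> parcs G} \<subseteq> pverts G"
proof -
  interpret pair_graph G by fact
  show ?thesis
    using arc_snd_in_verts by fastforce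
qed

text \<open>
  Row \<open>u\<close> of both the degree and the adjacency matrix sums to the degree of \<open>u\<close>, hence so does their
  affine combination. For a regular graph this says that the constant vectors are eigenvectors
  with the degree as eigenvalue.
\<close>

lemma alpha_entry_row_sum:
  assumes "pair_graph G" and "u \<in> pverts G"
  shows "(\<Sum>v\<in>pverts G. alpha_entry \<alpha> G u v) = real (degree_of G u)"
proof -
  have fin: "finite (pverts G)"
    by (rule pair_graph_finite_verts) fact
  have "pverts G \<inter> {v. (u, v) \<in> parcs G} = {v. (u, v) \<in> parcs G}"
    using neighbours_subset[OF assms(1)] by blast
  then have "(\<Sum>v\<in>pverts G. if (u, v) \<in> parcs G then 1 else 0) = real (degree_of G u)"
    using fin by (simp add: sum.If_cases degree_of_card)
  then show ?thesis
    using fin assms(2)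
    by (simp add: alpha_entry_def sum.distrib sum_distrib_left[symmetric] distrib_right[symmetric])
qed

lemma card_edge:
  assumes "pair_graph G" and "E \<in> edges G"
  shows "card E = 2"
proof -
  interpret pair_graph G by fact
  from assms(2) obtain u v where "E = {u, v}" and "(u, v) \<in> parcs G"
    by (auto simp: edges_def)
  then show ?thesis
    using pair_no_loops by fastforce
qed

section \<open>The edge corona\<close>

lemma edge_corona_arcs [simp]:
  "(Inl u, Inl v) \<in> parcs (edge_corona G m e H) \<longleftrightarrow> (u, v) \<in> parcs G"
  "(Inl u, Inr (i, x)) \<in> parcs (edge_corona G m e H) \<longleftrightarrow> i \<in> {1..m} \<and> u \<in> e i \<and> x \<in> pverts (H i)"
  "(Inr (i, x), Inl u) \<in> parcs (edge_corona G m e H) \<longleftrightarrow> i \<in> {1..m} \<and> u \<in> e i \<and> x \<in> pverts (H i)"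
  "(Inr (i, x), Inr (j, y)) \<in> parcs (edge_corona G m e H) \<longleftrightarrow>
     i \<in> {1..m} \<and> i = j \<and> (x, y) \<in> parcs (H i)"
  by (auto simp: edge_corona_def)

lemma edge_corona_verts:
  "pverts (edge_corona G m e H) = Inl ` pverts G \<union> Inr ` (SIGMA i:{1..m}. pverts (H i))"
  by (auto simp: edge_corona_def)

text \<open>
  The degree of a vertex of \<open>G\<close> in the corona sees only the orders of the \<open>H i\<close>; this is why
  the block on \<open>G\<close> is the same for both coronas.
\<close>

lemma degree_edge_corona_Inl:
  assumes "pair_graph G"
    and H: "\<And>i. i \<in> {1..m} \<Longrightarrow> pair_graph (H i) \<and> card (pverts (H i)) = q"
  shows "degree_of (edge_corona G m e H) (Inl u) = degree_of G u + q * card {i \<in> {1..m}. u \<in> e i}"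
proof -
  let ?I = "{i \<in> {1..m}. u \<in> e i}"
  have N: "{v. (Inl u, v) \<in> parcs (edge_corona G m e H)} =
      Inl ` {v. (u, v) \<in> parcs G} \<union> Inr ` (SIGMA i:?I. pverts (H i))"
  proof (rule Set.set_eqI)
    fix v show "v \<in> {v. (Inl u, v) \<in> parcs (edge_corona G m e H)} \<longleftrightarrow>
      v \<in> Inl ` {v. (u, v) \<in> parcs G} \<union> Inr ` (SIGMA i:?I. pverts (H i))"
      by (cases v) auto
  qed
  have fin: "finite (SIGMA i:?I. pverts (H i))"
    using H pair_graph_finite_verts by (intro finite_SigmaI) auto
  have "finite {v. (u, v) \<in> parcs G}"
    using neighbours_subset[OF assms(1)] pair_graph_finite_verts[OF assms(1)] finite_subset by blast
  moreover have "card (SIGMA i:?I. pverts (H i)) = q * card ?I"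
    using H pair_graph_finite_verts by (subst card_SigmaI) auto
  ultimately show ?thesis
    unfolding degree_of_card N using fin by (subst card_Un_disjoint) (auto simp: card_image)
qed

lemma degree_edge_corona_Inr:
  assumes "i \<in> {1..m}" and H: "pair_graph (H i)" and "x \<in> pverts (H i)" and "card (e i) = 2"
  shows "degree_of (edge_corona G m e H) (Inr (i, x)) = degree_of (H i) x + 2"
proof -
  have N: "{v. (Inr (i, x), v) \<in> parcs (edge_corona G m e H)} =
      Inl ` e i \<union> (\<lambda>y. Inr (i, y)) ` {y. (x, y) \<in> parcs (H i)}"
  proof (rule Set.set_eqI)
    fix v show "v \<in> {v. (Inr (i, x), v) \<in> parcs (edge_corona G m e H)} \<longleftrightarrow>
      v \<in> Inl ` e i \<union> (\<lambda>y. Inr (i, y)) ` {y. (x, y) \<in> parcs (H i)}"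
      using assms(1,3) by (cases v) auto
  qed
  have "finite {y. (x, y) \<in> parcs (H i)}"
    using neighbours_subset[OF H] pair_graph_finite_verts[OF H] finite_subset by blast
  moreover have "finite (e i)"
    using assms(4) card.infinite by fastforce
  ultimately show ?thesis
    unfolding degree_of_card N using assms(4)
    by (subst card_Un_disjoint) (auto simp: card_image inj_on_def)
qed

lemma distinct_concat_tagged:
  assumes "distinct is" and "\<And>i. i \<in> set is \<Longrightarrow> distinct (f i)"
  shows "distinct (concat (map (\<lambda>i. map (\<lambda>y. Inr (i, y)) (f i)) is))"
  using assms by (induction "is") (auto simp: distinct_map inj_on_def)

text \<open>
  The matrix \<open>X - c\<^sup>2 / (x - s) R R\<^sup>T\<close> of the introduction. The first subtracted term is the increase
  of the diagonal caused by the new neighbours. The \<open>(u, v)\<close> entry of \<open>R R\<^sup>T\<close> is \<open>q\<close> times the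
  number of edges containing both \<open>u\<close> and \<open>v\<close>.
\<close>

definition corona_schur_entry ::
  "real \<Rightarrow> 'a pair_pre_digraph \<Rightarrow> nat \<Rightarrow> (nat \<Rightarrow> 'a set) \<Rightarrow> nat \<Rightarrow> nat \<Rightarrow> real \<Rightarrow> 'a \<Rightarrow> 'a \<Rightarrow> real" where
  "corona_schur_entry \<alpha> G m e q r x u v =
     char_entry x (alpha_entry \<alpha> G) u v
     - (if u = v then \<alpha> * real (q * card {i \<in> {1..m}. u \<in> e i}) else 0)
     - real (card {i \<in> {1..m}. u \<in> e i \<and> v \<in> e i}) * real q * (1 - \<alpha>)^2 / (x - (r + 2 * \<alpha>))"

text \<open>
  The elimination described in the introduction, with \<open>f\<close> the characteristic matrix and
  \<open>g = c / (x - s) R\<^sup>T\<close>. The excluded value \<open>x = s\<close> is the one at which the constant vectors are in the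
  kernel of \<open>Y\<close> and cannot be used to clear the lower left block.
\<close>

lemma char_poly_edge_corona:
  fixes \<alpha> x :: real
  assumes G: "pair_graph G" and e: "bij_betw e {1..m} (edges G)"
    and H: "\<And>i. i \<in> {1..m} \<Longrightarrow> pair_graph (H i) \<and> regular r (H i) \<and> card (pverts (H i)) = q"
    and x: "x \<noteq> r + 2 * \<alpha>"
  shows "poly (char_poly (A_alpha \<alpha> (edge_corona G m e H))) x =
    det (list_mat (vertex_list G) (corona_schur_entry \<alpha> G m e q r x)) *
    (\<Prod>i\<leftarrow>[1..<Suc m]. poly (char_poly (A_alpha \<alpha> (H i))) (x - 2 * \<alpha>))"
proof -
  let ?C = "edge_corona G m e H"
  let ?V = "\<lambda>i. map (\<lambda>y. Inr (i, y)) (vertex_list (H i)) :: ('a + nat \<times> 'b) list"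
  define us where "us = (map Inl (vertex_list G) :: ('a + nat \<times> 'b) list)"
  define ws where "ws = concat (map ?V [1..<Suc m])"
  define f where "f = char_entry x (alpha_entry \<alpha> ?C)"
  define s where "s = r + 2 * \<alpha>"
  define g :: "'a + nat \<times> 'b \<Rightarrow> 'a + nat \<times> 'b \<Rightarrow> real" where
    "g w u = (case (w, u) of (Inr (i, y), Inl v) \<Rightarrow> (if v \<in> e i then (1 - \<alpha>) / (x - s) else 0) | _ \<Rightarrow> 0)"
    for w u
  have C: "pair_graph ?C"
    using G H e by (intro pair_graph_edge_corona) auto
  have HG: "pair_graph (H i)" and Hfin: "finite (pverts (H i))" and Hcard: "card (pverts (H i)) = q"
    and Hdeg: "y \<in> pverts (H i) \<Longrightarrow> degree_of (H i) y = r"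
    and Hlist: "distinct (vertex_list (H i))" "set (vertex_list (H i)) = pverts (H i)"
    and ecard: "card (e i) = 2" if "i \<in> {1..m}" for i y
    using H[OF that] pair_graph_finite_verts vertex_list card_edge[OF G] bij_betwE[OF e] that
    by (auto simp: regular_def)
  have interval: "set [1..<Suc m] = {1..m}"
    by auto
  have set_us: "set us = Inl ` pverts G"
    using vertex_list[OF G] by (simp add: us_def)
  have set_ws: "set ws = Inr ` (SIGMA i:{1..m}. pverts (H i))"
    using Hlist(2) unfolding ws_def set_concat set_map interval image_image by fastforce
  have dist_ws: "distinct ws"
    unfolding ws_def by (rule distinct_concat_tagged) (auto simp: Hlist simp del: upt_Suc)
  have sum_ws: "(\<Sum>w\<in>set ws. h w) = (\<Sum>i\<in>{1..m}. \<Sum>y\<in>pverts (H i). h (Inr (i, y)))"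
    for h :: "'a + nat \<times> 'b \<Rightarrow> real"
    unfolding set_ws using Hfin by (subst sum.reindex) (auto simp: sum.Sigma)
  have f_ll: "f (Inl u) (Inl v) = char_entry x (alpha_entry \<alpha> G) u v
      - (if u = v then \<alpha> * real (q * card {i \<in> {1..m}. u \<in> e i}) else 0)" for u v
    using degree_edge_corona_Inl[OF G, of m H q e u] H
    by (auto simp: f_def char_entry_def alpha_entry_def algebra_simps)
  have f_lr: "f (Inl u) (Inr (i, y)) = (if u \<in> e i then \<alpha> - 1 else 0)"
    and f_rl: "f (Inr (i, y)) (Inl u) = (if u \<in> e i then \<alpha> - 1 else 0)"
    if "i \<in> {1..m}" "y \<in> pverts (H i)" for u i y
    using that by (auto simp: f_def char_entry_def alpha_entry_def)
  have f_rr: "f (Inr (i, y)) (Inr (j, z)) =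
      (if i = j then char_entry (x - 2 * \<alpha>) (alpha_entry \<alpha> (H i)) y z else 0)"
    if "i \<in> {1..m}" "y \<in> pverts (H i)" for i y j z
    using that degree_edge_corona_Inr[of i m H y e G] HG[OF that(1)] ecard[OF that(1)]
    by (auto simp: f_def char_entry_def alpha_entry_def algebra_simps)
  have row: "(\<Sum>z\<in>pverts (H i). char_entry (x - 2 * \<alpha>) (alpha_entry \<alpha> (H i)) y z) = x - s"
    if "i \<in> {1..m}" "y \<in> pverts (H i)" for i y
    using that Hfin[OF that(1)] alpha_entry_row_sum[OF HG[OF that(1)] that(2), of \<alpha>] Hdeg[OF that]
    by (simp add: char_entry_def sum_subtractf s_def)
  \<comment> \<open>Only the block of \<open>w\<close> meets row \<open>w\<close>, and \<open>g\<close> is constant on it, so the row sum of that block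
    decides.\<close>
  have elim: "f w u + (\<Sum>v\<in>set ws. f w v * g v u) = 0" if "w \<in> set ws" "u \<in> set us" for w u
  proof -
    from that obtain i y v where w: "w = Inr (i, y)" and i: "i \<in> {1..m}" and y: "y \<in> pverts (H i)"
      and u: "u = Inl v"
      unfolding set_ws set_us by auto
    have "(\<Sum>v\<in>set ws. f w v * g v u) = (\<Sum>j\<in>{1..m}. \<Sum>z\<in>pverts (H j).
        (if j = i then char_entry (x - 2 * \<alpha>) (alpha_entry \<alpha> (H i)) y z * g (Inr (i, y)) u else 0))"
      unfolding sum_ws w u using i y by (intro sum.cong refl) (auto simp: f_rr g_def)
    also have "\<dots> = (\<Sum>j\<in>{1..m}. if j = i then (x - s) * g (Inr (i, y)) u else 0)"
      using i y by (intro sum.cong refl) (auto simp: sum_distrib_right[symmetric] row)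
    also have "\<dots> = (x - s) * g (Inr (i, y)) u"
      using i by simp
    also have "\<dots> = (if v \<in> e i then 1 - \<alpha> else 0)"
      using x by (simp add: g_def u s_def)
    finally show ?thesis
      using f_rl[OF i y] by (simp add: w u)
  qed
  have coeff: "(\<alpha> - 1) * ((1 - \<alpha>) / (x - s)) = - ((1 - \<alpha>)^2 / (x - s))"
    by (simp add: power2_eq_square minus_divide_left algebra_simps)
  have schur: "f (Inl u) (Inl v) + (\<Sum>w\<in>set ws. f (Inl u) w * g w (Inl v)) =
      corona_schur_entry \<alpha> G m e q r x u v" for u v
  proof -
    have "(\<Sum>w\<in>set ws. f (Inl u) w * g w (Inl v)) =
        (\<Sum>i\<in>{1..m}. if u \<in> e i \<and> v \<in> e i then - (real q * (1 - \<alpha>)^2 / (x - s)) else 0)"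
      unfolding sum_ws
    proof (intro sum.cong refl)
      fix i assume i: "i \<in> {1..m}"
      have "(\<Sum>y\<in>pverts (H i). f (Inl u) (Inr (i, y)) * g (Inr (i, y)) (Inl v)) =
        (\<Sum>y\<in>pverts (H i). if u \<in> e i \<and> v \<in> e i then - ((1 - \<alpha>)^2 / (x - s)) else 0)"
        using i coeff by (intro sum.cong refl) (auto simp: f_lr g_def)
      then show "(\<Sum>y\<in>pverts (H i). f (Inl u) (Inr (i, y)) * g (Inr (i, y)) (Inl v)) =
        (if u \<in> e i \<and> v \<in> e i then - (real q * (1 - \<alpha>)^2 / (x - s)) else 0)"
        using Hcard[OF i] by simp
    qed
    also have "\<dots> = - (real (card {i \<in> {1..m}. u \<in> e i \<and> v \<in> e i}) * real q * (1 - \<alpha>)^2 / (x - s))"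
      by (simp add: sum.If_cases Int_def)
    finally show ?thesis
      by (simp add: f_ll corona_schur_entry_def s_def)
  qed
  have "poly (char_poly (A_alpha \<alpha> ?C)) x = det (list_mat (us @ ws) f)"
    unfolding f_def
  proof (rule poly_char_poly_A_alpha[OF C])
    show "distinct (us @ ws)"
      using dist_ws vertex_list(1)[OF G] set_us set_ws by (auto simp: us_def distinct_map)
    show "set (us @ ws) = pverts ?C"
      by (simp add: set_us set_ws edge_corona_verts)
  qed
  also have "\<dots> = det (list_mat us (\<lambda>u v. f u v + (\<Sum>w\<in>set ws. f u w * g w v))) * det (list_mat ws f)"
    by (rule det_list_mat_schur[OF dist_ws elim])
  also have "list_mat us (\<lambda>u v. f u v + (\<Sum>w\<in>set ws. f u w * g w v)) =
      list_mat (vertex_list G) (corona_schur_entry \<alpha> G m e q r x)"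
    by (simp add: us_def list_mat_map schur)
  also have "det (list_mat ws f) = (\<Prod>vs\<leftarrow>map ?V [1..<Suc m]. det (list_mat vs f))"
    unfolding ws_def
  proof (rule det_list_mat_concat)
    show "distinct (concat (map ?V [1..<Suc m]))"
      using dist_ws by (simp only: ws_def)
    show "sorted_wrt (\<lambda>us ws. \<forall>u\<in>set us. \<forall>w\<in>set ws. f w u = 0) (map ?V [1..<Suc m])"
      unfolding sorted_wrt_map
      by (rule sorted_wrt_mono_rel[OF _ sorted_wrt_upt[of 1 "Suc m"]])
        (auto simp: Hlist f_rr simp del: upt_Suc)
  qed
  also have "\<dots> = (\<Prod>i\<leftarrow>[1..<Suc m]. poly (char_poly (A_alpha \<alpha> (H i))) (x - 2 * \<alpha>))"
  proof -
    have "det (list_mat (?V i) f) = poly (char_poly (A_alpha \<alpha> (H i))) (x - 2 * \<alpha>)"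
      if "i \<in> {1..m}" for i
      unfolding poly_char_poly_A_alpha[OF HG[OF that] Hlist[OF that]] list_mat_map
      using that by (intro arg_cong[where f = det] list_mat_cong) (simp add: Hlist f_rr)
    then have "map (\<lambda>i. det (list_mat (?V i) f)) [1..<Suc m] =
        map (\<lambda>i. poly (char_poly (A_alpha \<alpha> (H i))) (x - 2 * \<alpha>)) [1..<Suc m]"
      unfolding map_eq_conv interval by blast
    then show ?thesis
      by (simp only: map_map comp_def)
  qed
  finally show ?thesis .
qed

lemma poly_eq_off_point:
  fixes p p' :: "real poly"
  assumes "\<And>x. x \<noteq> a \<Longrightarrow> poly p x = poly p' x"
  shows "p = p'"
proof (rule ccontr)
  assume "p \<noteq> p'"
  then have "finite {x. poly (p - p') x = 0}"
    by (intro poly_roots_finite) simp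
  moreover have "UNIV - {a} \<subseteq> {x. poly (p - p') x = 0}"
    using assms by auto
  ultimately have "finite (UNIV - {a})"
    by (rule rev_finite_subset)
  then show False
    by (simp add: infinite_UNIV_char_0)
qed

theorem corollary4p3:
  fixes G :: "'a pair_pre_digraph"
    and H :: "nat \<Rightarrow> 'b pair_pre_digraph"
    and F :: "nat \<Rightarrow> 'c pair_pre_digraph"
    and e :: "nat \<Rightarrow> 'a set"
    and n m q r1 r2 :: nat
    and \<alpha> :: real
  assumes "pair_graph G" and "regular r1 G"
    and "card (pverts G) = n"
    and "card (edges G) = m" and "bij_betw e {1..m} (edges G)"
    and "\<And>i. i \<in> {1..m} \<Longrightarrow> pair_graph (H i) \<and> regular r2 (H i) \<and> card (pverts (H i)) = q"
    and "\<And>i. i \<in> {1..m} \<Longrightarrow> pair_graph (F i) \<and> regular r2 (F i) \<and> card (pverts (F i)) = q"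
    and "0 \<le> \<alpha>" and "\<alpha> \<le> 1"
    and "\<And>i. i \<in> {1..m} \<Longrightarrow> A_alpha_cospectral \<alpha> (H i) (F i)"
  shows "A_alpha_spectrum \<alpha> (edge_corona G m e H) = A_alpha_spectrum \<alpha> (edge_corona G m e F)
    \<and> (\<not> isomorphic (edge_corona G m e H) (edge_corona G m e F)
        \<longrightarrow> A_alpha_cospectral \<alpha> (edge_corona G m e H) (edge_corona G m e F))"
proof -
  let ?CH = "edge_corona G m e H" and ?CF = "edge_corona G m e F"
  have H: "pair_graph (H i)" and F: "pair_graph (F i)" if "i \<in> {1..m}" for i
    using assms(6,7) that by auto
  have C: "pair_graph ?CH" "pair_graph ?CF"
    using pair_graph_edge_corona assms(1,5) H F by blast+
  have blocks: "char_poly (A_alpha \<alpha> (H i)) = char_poly (A_alpha \<alpha> (F i))" if "i \<in> {1..m}" for i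
    using assms(10)[OF that] A_alpha_spectrum_eq_iff[OF H[OF that] F[OF that]]
    by (simp add: A_alpha_cospectral_def)
  have "char_poly (A_alpha \<alpha> ?CH) = char_poly (A_alpha \<alpha> ?CF)"
  proof (rule poly_eq_off_point)
    fix x assume x: "x \<noteq> real r2 + 2 * \<alpha>"
    have "map (\<lambda>i. poly (char_poly (A_alpha \<alpha> (H i))) (x - 2 * \<alpha>)) [1..<Suc m] =
        map (\<lambda>i. poly (char_poly (A_alpha \<alpha> (F i))) (x - 2 * \<alpha>)) [1..<Suc m]"
      using blocks by (auto simp del: upt_Suc)
    then show "poly (char_poly (A_alpha \<alpha> ?CH)) x = poly (char_poly (A_alpha \<alpha> ?CF)) x"
      by (simp only: char_poly_edge_corona[OF assms(1,5) assms(6) x]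
          char_poly_edge_corona[OF assms(1,5) assms(7) x])
  qed
  then have "A_alpha_spectrum \<alpha> ?CH = A_alpha_spectrum \<alpha> ?CF"
    by (simp add: A_alpha_spectrum_eq_iff[OF C])
  then show ?thesis
    by (simp add: A_alpha_cospectral_def)
qed

end
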